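(* For every integer $n\ge1$, the maximum gap for the general model satisfies $$\max_{I}\frac{\mathrm{OPT}(I)}{\mathrm{WST}(I)}=n+1,$$ where the maximum is over all instances $I$ of HRT-MSLQ with $|R|=n$ residents. Moreover, this equality holds even if the maximum is restricted to instances in which all residents have the same preference list (residents have a master list) and the preference lists of hospitals contain no ties.
   Context: An instance $I$ of HRT-MSLQ consists of a set $R=\{r_1,\dots,r_n\}$ of residents ($n\ge 1$) and a set $H=\{h_1,\dots,h_m\}$ of hospitals. Each resident $r$ has a complete preference list over $H$ that may contain ties (a total preorder $\succeq_r$; $\succ_r$ is strict preference), and each hospital likewise has a complete preference list over $R$ that may contain ties. Each hospital $h$ has an integer lower quota $\ell(h)$ and upper quota $u(h)$ with $0\le \ell(h)\le u(h)\le n$, $u(h)\ge 1$. Standing assumption: $|R|<\sum_{h\in H}u(h)$. An assignment is a set $M\subseteq R\times H$; $M(r)=\{h:(r,h)\in M\}$, $M(h)=\{r:(r,h)\in M\}$. $M$ is a matching if $|M(r)|\le 1$ for all $r$ and $|M(h)|\le u(h)$ for all $h$; then $M(r)$ also denotes the unique hospital of a matched resident $r$. A pair $(r,h)$ blocks a matching $M$ if (i) $r$ is unmatched in $M$ or $h\succ_r M(r)$, and (ii) $|M(h)|<u(h)$ or $h$ strictly prefers $r$ to at least one resident in $M(h)$. $M$ is stable if no pair blocks it. The score of $h$ in $M$ is $s_M(h)=\min\{1,|M(h)|/\ell(h)\}$, with $s_M(h)=1$ if $\ell(h)=0$; the score of $M$ is $s(M)=\sum_{h\in H}s_M(h)$.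 $\mathrm{OPT}(I)$ and $\mathrm{WST}(I)$ are respectively the maximum and minimum of $s(M)$ over all stable matchings $M$ of $I$. *)

theory Defs
  imports Complex_Main
begin

text \<open>
  Preference lists are weak preference relations: \<open>(x, y) \<in> resident_pref I r\<close> means that \<open>r\<close>
  finds \<open>x\<close> at least as good as \<open>y\<close>, and likewise for \<open>hospital_pref\<close>.
\<close>

record ('r, 'h) hrt_mslq =
  residents :: "'r set"
  hospitals :: "'h set"
  resident_pref :: "'r \<Rightarrow> 'h rel"
  hospital_pref :: "'h \<Rightarrow> 'r rel"
  lower_quota :: "'h \<Rightarrow> nat"
  upper_quota :: "'h \<Rightarrow> nat"

definition total_preorder_on :: "'a set \<Rightarrow> 'a rel \<Rightarrow> bool" where
  "total_preorder_on A P \<longleftrightarrow> preorder_on A P \<and> total_on A P"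

definition strictly_prefers :: "'a rel \<Rightarrow> 'a \<Rightarrow> 'a \<Rightarrow> bool" where
  "strictly_prefers P x y \<longleftrightarrow> (x, y) \<in> P \<and> (y, x) \<notin> P"

definition hrt_mslq_instance :: "('r, 'h) hrt_mslq \<Rightarrow> bool" where
  "hrt_mslq_instance I \<longleftrightarrow>
     finite (residents I) \<and> residents I \<noteq> {} \<and> finite (hospitals I) \<and>
     (\<forall>r\<in>residents I. total_preorder_on (hospitals I) (resident_pref I r)) \<and>
     (\<forall>h\<in>hospitals I. total_preorder_on (residents I) (hospital_pref I h)) \<and>
     (\<forall>h\<in>hospitals I. lower_quota I h \<le> upper_quota I h \<and>
        upper_quota I h \<le> card (residents I) \<and> 1 \<le> upper_quota I h) \<and>
     card (residents I) < (\<Sum>h\<in>hospitals I. upper_quota I h)"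

definition resident_master_list :: "('r, 'h) hrt_mslq \<Rightarrow> bool" where
  "resident_master_list I \<longleftrightarrow>
     (\<forall>r\<in>residents I. \<forall>r'\<in>residents I. resident_pref I r = resident_pref I r')"

definition hospitals_without_ties :: "('r, 'h) hrt_mslq \<Rightarrow> bool" where
  "hospitals_without_ties I \<longleftrightarrow> (\<forall>h\<in>hospitals I. antisym (hospital_pref I h))"

definition assigned_hospitals :: "('r \<times> 'h) set \<Rightarrow> 'r \<Rightarrow> 'h set" where
  "assigned_hospitals M r = {h. (r, h) \<in> M}"

definition assigned_residents :: "('r \<times> 'h) set \<Rightarrow> 'h \<Rightarrow> 'r set" where
  "assigned_residents M h = {r. (r, h) \<in> M}"

definition matching :: "('r, 'h) hrt_mslq \<Rightarrow> ('r \<times> 'h) set \<Rightarrow> bool" where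
  "matching I M \<longleftrightarrow> M \<subseteq> residents I \<times> hospitals I \<and>
     (\<forall>r\<in>residents I. card (assigned_hospitals M r) \<le> 1) \<and>
     (\<forall>h\<in>hospitals I. card (assigned_residents M h) \<le> upper_quota I h)"

text \<open>
  In a matching, \<open>assigned_hospitals M r\<close> has at most one element, so the bounded existential
  over it below speaks about the hospital of a matched resident.
\<close>

definition blocks :: "('r, 'h) hrt_mslq \<Rightarrow> ('r \<times> 'h) set \<Rightarrow> 'r \<Rightarrow> 'h \<Rightarrow> bool" where
  "blocks I M r h \<longleftrightarrow> r \<in> residents I \<and> h \<in> hospitals I \<and>
     (assigned_hospitals M r = {} \<or>
        (\<exists>h'\<in>assigned_hospitals M r. strictly_prefers (resident_pref I r) h h')) \<and>
     (card (assigned_residents M h) < upper_quota I h \<or>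
        (\<exists>r'\<in>assigned_residents M h. strictly_prefers (hospital_pref I h) r r'))"

definition stable_matching :: "('r, 'h) hrt_mslq \<Rightarrow> ('r \<times> 'h) set \<Rightarrow> bool" where
  "stable_matching I M \<longleftrightarrow> matching I M \<and> \<not> (\<exists>r h. blocks I M r h)"

definition hospital_score :: "('r, 'h) hrt_mslq \<Rightarrow> ('r \<times> 'h) set \<Rightarrow> 'h \<Rightarrow> real" where
  "hospital_score I M h =
     (if lower_quota I h = 0 then 1
      else min 1 (real (card (assigned_residents M h)) / real (lower_quota I h)))"

definition score :: "('r, 'h) hrt_mslq \<Rightarrow> ('r \<times> 'h) set \<Rightarrow> real" where
  "score I M = (\<Sum>h\<in>hospitals I. hospital_score I M h)"

text \<open>
  For an instance, the set of stable matchings is finite and nonempty, and every stable matching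
  has positive score: the upper quotas sum to more than the number of residents, so stability
  forces every resident to be matched.  Hence \<open>Max\<close> and \<open>Min\<close> are genuine extrema
  and \<open>OPT I / WST I\<close> never divides by zero.
\<close>

definition OPT :: "('r, 'h) hrt_mslq \<Rightarrow> real" where
  "OPT I = Max {score I M | M. stable_matching I M}"

definition WST :: "('r, 'h) hrt_mslq \<Rightarrow> real" where
  "WST I = Min {score I M | M. stable_matching I M}"

text \<open>
  \<open>Max\<close> is unspecified on infinite sets, and the number of hospitals is unbounded even for a
  fixed number of residents, so a set of ratios need not be finite.
\<close>

definition is_maximum :: "'a::linorder set \<Rightarrow> 'a \<Rightarrow> bool" where
  "is_maximum S x \<longleftrightarrow> x \<in> S \<and> (\<forall>y\<in>S. y \<le> x)"

end

theory Submission imports Defs begin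

text \<open>
  Since the upper quotas exceed the number \<open>n\<close> of residents, every stable matching assigns all
  residents.  Let \<open>a\<close> be the number of hospitals with lower quota \<open>0\<close>.  Each of the
  other hospitals scores at most the number of its residents, so the score is at most \<open>a + n\<close>.
  It is at least \<open>a\<close>, and also at least \<open>1\<close>, because a hospital scores at least \<open>1 / n\<close> per
  resident.  Hence the ratio is at most \<open>n + 1\<close>.  Equality holds when all residents are indifferent
  between \<open>n\<close> hospitals with both quotas \<open>1\<close> and one hospital with lower quota \<open>0\<close> and upper
  quota \<open>n\<close>: either every resident goes to the latter or each of the former gets one resident.
\<close>

section \<open>Existence of stable matchings\<close>

lemma total_preorder_onD:
  assumes "total_preorder_on A P"
  shows "x \<in> A \<Longrightarrow> (x, x) \<in> P"
    and "(x, y) \<in> P \<Longrightarrow> (y, z) \<in> P \<Longrightarrow> (x, z) \<in> P"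
    and "x \<in> A \<Longrightarrow> y \<in> A \<Longrightarrow> (x, y) \<in> P \<or> (y, x) \<in> P"
proof -
  have P: "refl_on A P" "trans P" "total_on A P"
    using assms by (auto simp: total_preorder_on_def preorder_on_def)
  show refl: "(x, x) \<in> P" if "x \<in> A" for x using P(1) that by (rule refl_onD)
  show "(x, y) \<in> P \<Longrightarrow> (y, z) \<in> P \<Longrightarrow> (x, z) \<in> P" using P(2) by (rule transD)
  show "x \<in> A \<Longrightarrow> y \<in> A \<Longrightarrow> (x, y) \<in> P \<or> (y, x) \<in> P"
    using P(3) refl by (metis total_on_def)
qed

lemma total_preorder_on_greatest:
  assumes P: "total_preorder_on A P" and "finite B" "B \<noteq> {}" "B \<subseteq> A"
  shows "\<exists>x\<in>B. \<forall>y\<in>B. (x, y) \<in> P"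
  using assms(2-4)
proof (induction B rule: finite_ne_induct)
  case (singleton x)
  then show ?case using total_preorder_onD(1)[OF P] by auto
next
  case (insert x B)
  then obtain z where z: "z \<in> B" "\<forall>y\<in>B. (z, y) \<in> P" by auto
  show ?case
  proof (cases "(z, x) \<in> P")
    case True
    then show ?thesis using z by auto
  next
    case False
    then have "(x, z) \<in> P" using total_preorder_onD(3)[OF P] insert.prems z(1) by blast
    then have "\<forall>y\<in>B. (x, y) \<in> P" using z(2) total_preorder_onD(2)[OF P] by blast
    moreover have "(x, x) \<in> P" using total_preorder_onD(1)[OF P] insert.prems by blast
    ultimately show ?thesis by blast
  qed
qed

lemma total_preorder_on_converse:
  "total_preorder_on A P \<Longrightarrow> total_preorder_on A (P\<inverse>)"
  by (auto simp: total_preorder_on_def preorder_on_def)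

lemma total_preorder_on_least:
  assumes "total_preorder_on A P" "finite B" "B \<noteq> {}" "B \<subseteq> A"
  shows "\<exists>x\<in>B. \<forall>y\<in>B. (y, x) \<in> P"
  using total_preorder_on_greatest[OF total_preorder_on_converse[OF assms(1)] assms(2-4)] by simp

text \<open>
  The invariant of resident-proposing deferred acceptance: \<open>P\<close> is the set of proposals made so
  far and \<open>M\<close> the set of those currently held.
\<close>

definition deferred_acceptance_state ::
    "('r, 'h) hrt_mslq \<Rightarrow> ('r \<times> 'h) set \<Rightarrow> ('r \<times> 'h) set \<Rightarrow> bool" where
  "deferred_acceptance_state I P M \<longleftrightarrow>
     matching I M \<and> M \<subseteq> P \<and> P \<subseteq> residents I \<times> hospitals I \<and>
     (\<forall>(r, h)\<in>P - M. upper_quota I h \<le> card (assigned_residents M h) \<and>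
        (\<forall>r'\<in>assigned_residents M h. (r', r) \<in> hospital_pref I h)) \<and>
     (\<forall>(r, h)\<in>M. \<forall>h'\<in>hospitals I.
        strictly_prefers (resident_pref I r) h' h \<longrightarrow> (r, h') \<in> P)"

lemma deferred_acceptance_stateI:
  assumes "matching I M" "M \<subseteq> P" "P \<subseteq> residents I \<times> hospitals I"
    and "\<And>r h. (r, h) \<in> P - M \<Longrightarrow> upper_quota I h \<le> card (assigned_residents M h)"
    and "\<And>r h r'. (r, h) \<in> P - M \<Longrightarrow> r' \<in> assigned_residents M h
           \<Longrightarrow> (r', r) \<in> hospital_pref I h"
    and "\<And>r h h'. (r, h) \<in> M \<Longrightarrow> h' \<in> hospitals I
           \<Longrightarrow> strictly_prefers (resident_pref I r) h' h \<Longrightarrow> (r, h') \<in> P"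
  shows "deferred_acceptance_state I P M"
  unfolding deferred_acceptance_state_def using assms(1-3)
  by (intro conjI ballI) (auto intro: assms(4-6))

section \<open>Matchings as finite relations\<close>

lemma matching_finite:
  assumes "hrt_mslq_instance I" "matching I M"
  shows "finite M" "finite (assigned_residents M h)" "finite (assigned_hospitals M r)"
proof -
  show M: "finite M"
    using assms unfolding hrt_mslq_instance_def matching_def
    by (meson finite_SigmaI finite_subset)
  have "assigned_residents M h \<subseteq> fst ` M" "assigned_hospitals M r \<subseteq> snd ` M"
    unfolding assigned_residents_def assigned_hospitals_def by force+
  then show "finite (assigned_residents M h)" "finite (assigned_hospitals M r)"
    using M by (meson finite_imageI finite_subset)+
qed

lemma matching_functional:
  assumes I: "hrt_mslq_instance I" and M: "matching I M" and "(r, h) \<in> M" "(r, h') \<in> M"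
  shows "h = h'"
proof -
  have "card (assigned_hospitals M r) \<le> 1" using M assms(3) unfolding matching_def by auto
  then show ?thesis
    \<comment> \<open>Finiteness is essential: an infinite set has \<open>card\<close> 0, so the
      bound by 1 alone would not force uniqueness.\<close>
    using assms(3,4) matching_finite(3)[OF I M, of r]
    by (auto simp: assigned_hospitals_def card_le_Suc0_iff_eq)
qed

lemma assigned_residents_insert:
  "assigned_residents (insert (r, h) M) k =
     (if k = h then insert r (assigned_residents M k) else assigned_residents M k)"
  by (auto simp: assigned_residents_def)

lemma assigned_residents_delete:
  "assigned_residents (M - {(r, h)}) k =
     (if k = h then assigned_residents M k - {r} else assigned_residents M k)"
  by (auto simp: assigned_residents_def)

lemma assigned_hospitals_insert:
  "assigned_hospitals (insert (r, h) M) q =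
     (if q = r then insert h (assigned_hospitals M q) else assigned_hospitals M q)"
  by (auto simp: assigned_hospitals_def)

text \<open>An unmatched \<open>r\<close> gains at most \<open>h\<close>, and nobody else gains
  anything. Allowing a subset \<open>N\<close> covers both outcomes of a proposal: a free place is
  filled, or somebody is turned away.\<close>

lemma card_assigned_hospitals_insert_unmatched:
  assumes I: "hrt_mslq_instance I" and M: "matching I M"
    and unm: "assigned_hospitals M r = {}" and q: "q \<in> residents I"
    and sub: "N \<subseteq> insert (r, h) M"
  shows "card (assigned_hospitals N q) \<le> 1"
proof -
  have "assigned_hospitals N q \<subseteq> assigned_hospitals (insert (r, h) M) q"
    using sub unfolding assigned_hospitals_def by auto
  moreover have "finite (assigned_hospitals (insert (r, h) M) q)"
    using matching_finite(3)[OF I M] by (simp add: assigned_hospitals_insert)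
  moreover have "card (assigned_hospitals (insert (r, h) M) q) \<le> 1"
    using M q unm unfolding matching_def by (auto simp: assigned_hospitals_insert)
  ultimately show ?thesis by (meson card_mono le_trans)
qed

text \<open>One round of deferred acceptance: \<open>r\<close> proposes to a best hospital among
  those not yet tried. The given \<open>h0\<close> only shows that such a hospital exists; the
  chosen \<open>h\<close> may differ.\<close>

lemma deferred_acceptance_step:
  assumes I: "hrt_mslq_instance I" and S: "deferred_acceptance_state I P M"
    and r: "r \<in> residents I" and unm: "assigned_hospitals M r = {}"
    and h0: "h0 \<in> hospitals I" "(r, h0) \<notin> P"
  shows "\<exists>h M'. (r, h) \<notin> P \<and> deferred_acceptance_state I (insert (r, h) P) M'"
proof -
  have M: "matching I M" and MP: "M \<subseteq> P" and PRH: "P \<subseteq> residents I \<times> hospitals I"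
    and rej: "\<And>q k. (q, k) \<in> P - M \<Longrightarrow> upper_quota I k \<le> card (assigned_residents M k)"
    and rejp: "\<And>q k q'. (q, k) \<in> P - M \<Longrightarrow> q' \<in> assigned_residents M k
                 \<Longrightarrow> (q', q) \<in> hospital_pref I k"
    and proposed: "\<And>q k k'. (q, k) \<in> M \<Longrightarrow> k' \<in> hospitals I \<Longrightarrow>
                 strictly_prefers (resident_pref I q) k' k \<Longrightarrow> (q, k') \<in> P"
    using S unfolding deferred_acceptance_state_def by blast+
  have MRH: "M \<subseteq> residents I \<times> hospitals I" using MP PRH by blast
  have u: "\<And>k. k \<in> hospitals I \<Longrightarrow> card (assigned_residents M k) \<le> upper_quota I k"
    using M unfolding matching_def by auto
  define C where "C = {k \<in> hospitals I. (r, k) \<notin> P}"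
  have "total_preorder_on (hospitals I) (resident_pref I r)" "finite C" "C \<noteq> {}"
    "C \<subseteq> hospitals I"
    using I r h0 unfolding hrt_mslq_instance_def C_def by auto
  then obtain h where hC: "h \<in> C" and best: "\<forall>k\<in>C. (h, k) \<in> resident_pref I r"
    using total_preorder_on_greatest by meson
  have h: "h \<in> hospitals I" "(r, h) \<notin> P" using hC unfolding C_def by auto
  \<comment> \<open>Since \<open>h\<close> is best in \<open>C\<close>, anything strictly better
    lies outside \<open>C\<close>, so it has already been tried.\<close>
  have rh: "(r, h') \<in> P"
    if "h' \<in> hospitals I" "strictly_prefers (resident_pref I r) h' h" for h'
    using that best unfolding C_def strictly_prefers_def by auto
  have rM: "r \<notin> assigned_residents M h"
    using h MP unfolding assigned_residents_def by auto
  have fin: "finite (assigned_residents M k)" for k using matching_finite(2)[OF I M] .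
  show ?thesis
  proof (cases "card (assigned_residents M h) < upper_quota I h")
    case True
    let ?M = "insert (r, h) M"
    have "card (assigned_residents ?M k) \<le> upper_quota I k" if "k \<in> hospitals I" for k
      using that u True rM fin by (auto simp: assigned_residents_insert)
    moreover have "card (assigned_hospitals ?M q) \<le> 1" if "q \<in> residents I" for q
      using card_assigned_hospitals_insert_unmatched[OF I M unm that] by blast
    ultimately have mat: "matching I ?M"
      using MRH r h unfolding matching_def by auto
    \<comment> \<open>A hospital with a free place has rejected nobody, so earlier rejections
      concern only hospitals whose residents stay the same.\<close>
    have held: "assigned_residents ?M k = assigned_residents M k" if "(q, k) \<in> P - M" for q k
      using rej[OF that] True by (auto simp: assigned_residents_insert)
    have "deferred_acceptance_state I (insert (r, h) P) ?M"
      unfolding deferred_acceptance_state_def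
      using mat MP PRH r h rej rejp proposed rh held by auto
    then show ?thesis using h by blast
  next
    case False
    let ?A = "insert r (assigned_residents M h)"
    have tp: "total_preorder_on (residents I) (hospital_pref I h)"
      using I h unfolding hrt_mslq_instance_def by auto
    have AR: "?A \<subseteq> residents I"
      using MRH r unfolding assigned_residents_def by auto
    then obtain w where w: "w \<in> ?A" and worst: "\<forall>q\<in>?A. (q, w) \<in> hospital_pref I h"
      using total_preorder_on_least[OF tp] fin by (metis finite_insert insert_not_empty)
    \<comment> \<open>The full hospital \<open>h\<close> drops a worst candidate \<open>w\<close>.
      If \<open>w = r\<close>, then \<open>M'\<close> is \<open>M\<close>; otherwise
      \<open>r\<close> replaces \<open>w\<close>. Either way all occupancies are preserved.\<close>
    define M' where "M' = insert (r, h) M - {(w, h)}"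
    have M'_sub: "M' \<subseteq> insert (r, h) M" unfolding M'_def by blast
    have resM: "assigned_residents M' k =
        (if k = h then ?A - {w} else assigned_residents M k)" for k
      by (simp add: M'_def assigned_residents_insert assigned_residents_delete)
    have cardM: "card (assigned_residents M' k) = card (assigned_residents M k)" for k
      using w rM fin by (simp add: resM card_Diff_singleton)
    have "card (assigned_hospitals M' q) \<le> 1" if "q \<in> residents I" for q
      using card_assigned_hospitals_insert_unmatched[OF I M unm that M'_sub] .
    then have mat: "matching I M'"
      using MRH r h u M'_sub unfolding matching_def cardM by blast
    have old: "(q, k) \<in> P - M"
      if "(q, k) \<in> insert (r, h) P - M'" "(q, k) \<noteq> (w, h)" for q k
      using that unfolding M'_def by auto
    have full: "upper_quota I k \<le> card (assigned_residents M' k)"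
      if "(q, k) \<in> insert (r, h) P - M'" for q k
    proof (cases "(q, k) = (w, h)")
      case True
      then show ?thesis using \<open>\<not> card _ < _\<close> unfolding cardM by simp
    next
      case False
      then show ?thesis using rej[OF old[OF that]] unfolding cardM by blast
    qed
    have pref: "(q', q) \<in> hospital_pref I k"
      if qk: "(q, k) \<in> insert (r, h) P - M'" and q': "q' \<in> assigned_residents M' k" for q k q'
    proof (cases "k = h")
      case False
      then show ?thesis using rejp[OF old[OF qk]] q' unfolding resM by simp
    next
      case True
      have q'w: "(q', w) \<in> hospital_pref I h"
        using q' worst True by (auto simp: resM)
      show ?thesis
      proof (cases "q = w")
        case True
        then show ?thesis using q'w \<open>k = h\<close> by simp
      next
        case False
        then have q: "(q, h) \<in> P - M" using old[OF qk] True by simp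
        show ?thesis
        \<comment> \<open>Here \<open>q\<close> was rejected by \<open>h\<close> earlier. If
          \<open>w = r\<close>, the residents of \<open>h\<close> are unchanged. Otherwise
          \<open>q'\<close> may be the newcomer \<open>r\<close>, on whom \<open>rejp\<close> is
          silent; the chain \<open>q'\<close>, \<open>w\<close>, \<open>q\<close> settles it, as
          \<open>w\<close> was held when \<open>q\<close> was already rejected.\<close>
        proof (cases "w = r")
          case True
          then show ?thesis using q q' rejp \<open>k = h\<close> by (auto simp: resM)
        next
          case False
          then have "(w, q) \<in> hospital_pref I h" using w rejp[OF q] by blast
          then show ?thesis using q'w total_preorder_onD(2)[OF tp] True by blast
        qed
      qed
    qed
    have proposed': "(q, k') \<in> insert (r, h) P"
      if "(q, k) \<in> M'" "k' \<in> hospitals I" "strictly_prefers (resident_pref I q) k' k" for q k k'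
      using that proposed rh M'_sub by blast
    have "M' \<subseteq> insert (r, h) P" "insert (r, h) P \<subseteq> residents I \<times> hospitals I"
      using M'_sub MP PRH r h by auto
    with mat have "deferred_acceptance_state I (insert (r, h) P) M'"
      using full pref proposed' by (rule deferred_acceptance_stateI)
    then show ?thesis using h by blast
  qed
qed

text \<open>A proposal set maximal under inclusion replaces a run of the algorithm. By
  \<open>deferred_acceptance_step\<close>, any resident still unmatched there has proposed to every
  hospital.\<close>

lemma ex_stable_matching:
  assumes I: "hrt_mslq_instance I"
  shows "\<exists>M. stable_matching I M"
proof -
  let ?S = "{P. \<exists>M. deferred_acceptance_state I P M}"
  have "?S \<subseteq> Pow (residents I \<times> hospitals I)"
    unfolding deferred_acceptance_state_def by auto
  then have "finite ?S"
    using I unfolding hrt_mslq_instance_def by (meson finite_Pow_iff finite_SigmaI finite_subset)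
  moreover have "{} \<in> ?S"
    by (auto simp: deferred_acceptance_state_def matching_def assigned_hospitals_def
        assigned_residents_def)
  ultimately obtain P where P: "P \<in> ?S" and max: "\<And>Q. Q \<in> ?S \<Longrightarrow> P \<subseteq> Q \<Longrightarrow> P = Q"
    using finite_has_maximal[of ?S] by blast
  obtain M where S: "deferred_acceptance_state I P M" using P by auto
  have M: "matching I M" and MP: "M \<subseteq> P"
    using S unfolding deferred_acceptance_state_def by auto
  have all: "(r, h) \<in> P"
    if "r \<in> residents I" "assigned_hospitals M r = {}" "h \<in> hospitals I" for r h
    using deferred_acceptance_step[OF I S that(1,2,3)] max by blast
  have "\<not> blocks I M r h" for r h
  proof
    assume b: "blocks I M r h"
    then have r: "r \<in> residents I" and h: "h \<in> hospitals I" unfolding blocks_def by auto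
    \<comment> \<open>A blocking pair would be a rejected proposal, but a hospital that has rejected
      \<open>r\<close> is full of residents it likes at least as much.\<close>
    have "(r, h) \<in> P - M"
    proof (cases "assigned_hospitals M r = {}")
      case True
      then show ?thesis using all r h by (auto simp: assigned_hospitals_def)
    next
      case False
      then obtain h' where h': "(r, h') \<in> M" "strictly_prefers (resident_pref I r) h h'"
        using b unfolding blocks_def assigned_hospitals_def by auto
      then have "(r, h) \<in> P" using S h unfolding deferred_acceptance_state_def by blast
      moreover have "(r, h) \<notin> M"
        using matching_functional[OF I M h'(1)] h'(2) unfolding strictly_prefers_def by auto
      ultimately show ?thesis by simp
    qed
    then have "upper_quota I h \<le> card (assigned_residents M h)"
      "\<forall>r'\<in>assigned_residents M h. (r', r) \<in> hospital_pref I h"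
      using S unfolding deferred_acceptance_state_def by blast+
    then show False using b unfolding blocks_def strictly_prefers_def by auto
  qed
  then show ?thesis using M unfolding stable_matching_def by blast
qed

section \<open>Bounds on the score\<close>

lemma matching_card_residents:
  assumes I: "hrt_mslq_instance I" and M: "matching I M"
  shows "card M = (\<Sum>r\<in>residents I. card (assigned_hospitals M r))"
proof -
  have "M = Sigma (residents I) (assigned_hospitals M)"
    using M unfolding matching_def assigned_hospitals_def by auto
  then have "card M = card (Sigma (residents I) (assigned_hospitals M))" by simp
  then show ?thesis
    using I matching_finite(3)[OF I M] by (simp add: hrt_mslq_instance_def)
qed

lemma matching_card_hospitals:
  assumes I: "hrt_mslq_instance I" and M: "matching I M"
  shows "card M = (\<Sum>h\<in>hospitals I. card (assigned_residents M h))"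
proof -
  have "M\<inverse> = Sigma (hospitals I) (assigned_residents M)"
    using M unfolding matching_def assigned_residents_def by auto
  then have "card (M\<inverse>) = card (Sigma (hospitals I) (assigned_residents M))" by simp
  then show ?thesis
    using I matching_finite(2)[OF I M] by (simp add: hrt_mslq_instance_def)
qed

text \<open>An unmatched resident blocks with any hospital that has a free place. So all hospitals
  would be full, and \<open>M\<close> would have at least as many pairs as the sum of the upper
  quotas, which exceeds the number of residents.\<close>

lemma stable_matching_card:
  assumes I: "hrt_mslq_instance I" and S: "stable_matching I M"
  shows "card M = card (residents I)"
proof -
  have M: "matching I M" using S unfolding stable_matching_def by simp
  have le: "card (assigned_hospitals M r) \<le> 1" if "r \<in> residents I" for r
    using M that unfolding matching_def by simp
  then have "card M \<le> (\<Sum>r\<in>residents I. 1)"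
    unfolding matching_card_residents[OF I M] by (rule sum_mono)
  then have leR: "card M \<le> card (residents I)" by simp
  have "assigned_hospitals M r \<noteq> {}" if r: "r \<in> residents I" for r
  proof
    assume "assigned_hospitals M r = {}"
    then have "upper_quota I h \<le> card (assigned_residents M h)" if "h \<in> hospitals I" for h
      using S r that unfolding stable_matching_def blocks_def by (meson not_le)
    then have "(\<Sum>h\<in>hospitals I. upper_quota I h) \<le> card M"
      unfolding matching_card_hospitals[OF I M] by (rule sum_mono)
    then show False using leR I unfolding hrt_mslq_instance_def by linarith
  qed
  then have "card (assigned_hospitals M r) = 1" if "r \<in> residents I" for r
    using le[OF that] that matching_finite(3)[OF I M, of r]
    by (metis card_0_eq le_antisym less_one not_le)
  then show ?thesis unfolding matching_card_residents[OF I M] by simp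
qed

definition zero_quota_hospitals :: "('r, 'h) hrt_mslq \<Rightarrow> 'h set" where
  "zero_quota_hospitals I = {h \<in> hospitals I. lower_quota I h = 0}"

lemma card_zero_quota_hospitals:
  "hrt_mslq_instance I \<Longrightarrow>
     real (card (zero_quota_hospitals I)) =
       (\<Sum>h\<in>hospitals I. if lower_quota I h = 0 then 1 else 0)"
  by (simp add: zero_quota_hospitals_def hrt_mslq_instance_def flip: sum.inter_filter)

lemma stable_matching_sum_card:
  assumes "hrt_mslq_instance I" "stable_matching I M"
  shows "(\<Sum>h\<in>hospitals I. real (card (assigned_residents M h))) = real (card (residents I))"
  using matching_card_hospitals[of I M] stable_matching_card[OF assms] assms
  by (simp add: stable_matching_def flip: of_nat_sum)

lemma score_le:
  assumes I: "hrt_mslq_instance I" and S: "stable_matching I M"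
  shows "score I M \<le> card (zero_quota_hospitals I) + card (residents I)"
proof -
  have "hospital_score I M h \<le>
      (if lower_quota I h = 0 then 1 else 0) + real (card (assigned_residents M h))" for h
  proof -
    \<comment> \<open>Used with \<open>y\<close> a nonzero lower quota, which is at least 1.\<close>
    have "x / y \<le> x" if "x \<ge> 0" "y \<ge> 1" for x y :: real
      using that by (simp add: divide_le_eq mult_le_cancel_left1)
    then show ?thesis
      by (auto simp: hospital_score_def min_le_iff_disj Suc_leI)
  qed
  then have "score I M \<le> (\<Sum>h\<in>hospitals I.
      (if lower_quota I h = 0 then 1 else 0) + real (card (assigned_residents M h)))"
    unfolding score_def by (rule sum_mono)
  then show ?thesis
    by (simp add: sum.distrib card_zero_quota_hospitals[OF I] stable_matching_sum_card[OF I S])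
qed

lemma score_ge_card_zero_quota_hospitals:
  assumes I: "hrt_mslq_instance I"
  shows "card (zero_quota_hospitals I) \<le> score I M"
  unfolding card_zero_quota_hospitals[OF I] score_def
  by (rule sum_mono) (simp add: hospital_score_def)

lemma score_ge_1:
  assumes I: "hrt_mslq_instance I" and S: "stable_matching I M"
  shows "1 \<le> score I M"
proof -
  let ?n = "real (card (residents I))"
  have n: "?n > 0" using I unfolding hrt_mslq_instance_def by (simp add: card_gt_0_iff)
  \<comment> \<open>Both the lower quota and the occupancy are at most the upper quota, hence at
    most \<open>?n\<close>. So the quotient is below each argument of \<open>min\<close>, and below
    1 when the lower quota is 0. Summed over all hospitals, the quotients give 1.\<close>
  have "real (card (assigned_residents M h)) / ?n \<le> hospital_score I M h"
    if h: "h \<in> hospitals I" for h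
  proof -
    have u: "lower_quota I h \<le> card (residents I)" "card (assigned_residents M h) \<le> card (residents I)"
      using h I S unfolding hrt_mslq_instance_def stable_matching_def matching_def
      by (meson le_trans)+
    then show ?thesis
      using n unfolding hospital_score_def by (auto simp: divide_le_eq_1 intro!: divide_left_mono)
  qed
  then have "(\<Sum>h\<in>hospitals I. real (card (assigned_residents M h)) / ?n) \<le> score I M"
    unfolding score_def by (rule sum_mono)
  then show ?thesis
    using n by (simp add: stable_matching_sum_card[OF I S] flip: sum_divide_distrib)
qed

section \<open>Attainment of \<open>OPT\<close> and \<open>WST\<close>\<close>

lemma finite_stable_scores:
  assumes I: "hrt_mslq_instance I"
  shows "finite {score I M | M. stable_matching I M}"
proof -
  have "{M. stable_matching I M} \<subseteq> Pow (residents I \<times> hospitals I)"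
    unfolding stable_matching_def matching_def by auto
  then have "finite {M. stable_matching I M}"
    using I unfolding hrt_mslq_instance_def by (meson finite_Pow_iff finite_SigmaI finite_subset)
  then show ?thesis by simp
qed

text \<open>\<open>Max\<close> of a finite set is a member only if the set is nonempty, which is
  where the existence of stable matchings enters.\<close>

lemma OPT_attained:
  assumes I: "hrt_mslq_instance I"
  obtains M where "stable_matching I M" "OPT I = score I M"
proof -
  have "OPT I \<in> {score I M | M. stable_matching I M}"
    unfolding OPT_def using Max_in[OF finite_stable_scores[OF I]] ex_stable_matching[OF I] by blast
  then show ?thesis using that by blast
qed

lemma WST_attained:
  assumes I: "hrt_mslq_instance I"
  obtains M where "stable_matching I M" "WST I = score I M"
proof -
  have "WST I \<in> {score I M | M. stable_matching I M}"
    unfolding WST_def using Min_in[OF finite_stable_scores[OF I]] ex_stable_matching[OF I] by blast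
  then show ?thesis using that by blast
qed

lemma score_le_OPT: "hrt_mslq_instance I \<Longrightarrow> stable_matching I M \<Longrightarrow> score I M \<le> OPT I"
  unfolding OPT_def by (rule Max_ge[OF finite_stable_scores]) auto

lemma WST_le_score: "hrt_mslq_instance I \<Longrightarrow> stable_matching I M \<Longrightarrow> WST I \<le> score I M"
  unfolding WST_def by (rule Min_le[OF finite_stable_scores]) auto

lemma OPT_div_WST_le:
  assumes I: "hrt_mslq_instance I"
  shows "OPT I / WST I \<le> card (residents I) + 1"
proof -
  define a where "a = real (card (zero_quota_hospitals I))"
  define n where "n = real (card (residents I))"
  obtain N where "stable_matching I N" "OPT I = score I N" using OPT_attained[OF I] .
  then have opt: "OPT I \<le> a + n" using score_le[OF I] by (simp add: a_def n_def)
  obtain M where "stable_matching I M" "WST I = score I M" using WST_attained[OF I] .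
  then have wst: "a \<le> WST I" "1 \<le> WST I"
    using score_ge_card_zero_quota_hospitals[OF I] score_ge_1[OF I] by (simp_all add: a_def)
  \<comment> \<open>In \<open>a + n\<close>, the term \<open>a\<close> is absorbed by one copy of
    \<open>WST I\<close> and \<open>n\<close> by \<open>n\<close> further copies.\<close>
  have "n \<le> n * WST I" using wst(2) by (simp add: n_def mult_le_cancel_left1)
  then have "OPT I \<le> (n + 1) * WST I" using opt wst(1) by (simp add: algebra_simps)
  then show ?thesis using wst(2) by (simp add: divide_le_eq n_def add.commute)
qed

section \<open>An instance attaining the bound\<close>

text \<open>Hospital \<open>n\<close> is the one with lower quota 0. Hospitals rank residents by
  number, smaller being better; \<open>y < n\<close> confines this order to the residents.\<close>

definition indifferent_instance :: "nat \<Rightarrow> (nat, nat) hrt_mslq" where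
  "indifferent_instance n = \<lparr>
     residents = {..<n},
     hospitals = {..n},
     resident_pref = (\<lambda>_. {..n} \<times> {..n}),
     hospital_pref = (\<lambda>_. {(x, y). x \<le> y \<and> y < n}),
     lower_quota = (\<lambda>h. if h = n then 0 else 1),
     upper_quota = (\<lambda>h. if h = n then n else 1)\<rparr>"

lemma indifferent_instance_simps [simp]:
  "residents (indifferent_instance n) = {..<n}"
  "hospitals (indifferent_instance n) = {..n}"
  "resident_pref (indifferent_instance n) r = {..n} \<times> {..n}"
  "hospital_pref (indifferent_instance n) h = {(x, y). x \<le> y \<and> y < n}"
  "lower_quota (indifferent_instance n) h = (if h = n then 0 else 1)"
  "upper_quota (indifferent_instance n) h = (if h = n then n else 1)"
  by (simp_all add: indifferent_instance_def)

lemma indifferent_instance: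
  assumes "n \<ge> 1"
  shows "hrt_mslq_instance (indifferent_instance n)"
proof -
  have "(\<Sum>h\<le>n. if h = n then n else 1) = 2 * n"
    by (simp flip: lessThan_Suc_atMost)
  then show ?thesis
    using assms by (auto simp: hrt_mslq_instance_def total_preorder_on_def preorder_on_def
        refl_on_def trans_def total_on_def lessThan_empty_iff)
qed

lemma indifferent_instance_master_list: "resident_master_list (indifferent_instance n)"
  by (simp add: resident_master_list_def)

lemma indifferent_instance_without_ties: "hospitals_without_ties (indifferent_instance n)"
  by (auto simp: hospitals_without_ties_def antisym_def)

text \<open>A matched resident who is indifferent between all hospitals never strictly prefers
  another one, so no pair can block.\<close>

lemma indifferent_instance_stable:
  assumes M: "matching (indifferent_instance n) M"
    and "\<And>r. r < n \<Longrightarrow> assigned_hospitals M r \<noteq> {}"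
  shows "stable_matching (indifferent_instance n) M"
  using assms unfolding stable_matching_def blocks_def matching_def
  by (auto simp: strictly_prefers_def assigned_hospitals_def)

lemma OPT_div_WST_indifferent_instance:
  assumes n: "n \<ge> 1"
  shows "OPT (indifferent_instance n) / WST (indifferent_instance n) = real n + 1"
proof -
  let ?I = "indifferent_instance n"
  \<comment> \<open>\<open>?B\<close> sends resident \<open>r\<close> to hospital \<open>r\<close>;
    hospital \<open>n\<close> stays empty yet scores 1. \<open>?W\<close> sends everyone to hospital
    \<open>n\<close>.\<close>
  let ?B = "Id_on {..<n}" and ?W = "{..<n} \<times> {n}"
  note I = indifferent_instance[OF n]
  have B: "assigned_hospitals ?B r = {r}" "assigned_residents ?B r = {r}" if "r < n" for r
    using that by (auto simp: assigned_hospitals_def assigned_residents_def)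
  have B': "assigned_residents ?B n = {}"
    by (auto simp: assigned_residents_def)
  have W: "assigned_hospitals ?W r = {n}" "assigned_residents ?W r = {}" if "r < n" for r
    using that by (auto simp: assigned_hospitals_def assigned_residents_def)
  have W': "assigned_residents ?W n = {..<n}"
    by (auto simp: assigned_residents_def)
  have "stable_matching ?I ?B"
    by (rule indifferent_instance_stable) (auto simp: matching_def B B' le_less)
  moreover have "score ?I ?B = real n + 1"
    by (simp add: score_def hospital_score_def B flip: lessThan_Suc_atMost)
  ultimately have opt: "real n + 1 \<le> OPT ?I" using score_le_OPT[OF I] by fastforce
  have "stable_matching ?I ?W"
    by (rule indifferent_instance_stable) (auto simp: matching_def W W' le_less)
  moreover have "score ?I ?W = 1"
    by (simp add: score_def hospital_score_def W flip: lessThan_Suc_atMost)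
  ultimately have wst: "WST ?I \<le> 1" using WST_le_score[OF I] by fastforce
  obtain M where "stable_matching ?I M" "WST ?I = score ?I M" using WST_attained[OF I] .
  then have "WST ?I = 1" using wst score_ge_1[OF I] by fastforce
  \<comment> \<open>With \<open>WST ?I\<close> equal to 1, the general bound on the ratio supplies
    the missing upper bound on \<open>OPT ?I\<close>.\<close>
  then show ?thesis using opt OPT_div_WST_le[OF I] by simp
qed

theorem proposition6:
  fixes n :: nat
  assumes "n \<ge> 1"
  shows "is_maximum
           {OPT I / WST I | I :: (nat, nat) hrt_mslq.
              hrt_mslq_instance I \<and> card (residents I) = n}
           (real n + 1) \<and>
         is_maximum
           {OPT I / WST I | I :: (nat, nat) hrt_mslq.
              hrt_mslq_instance I \<and> card (residents I) = n \<and>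
              resident_master_list I \<and> hospitals_without_ties I}
           (real n + 1)"
proof -
  let ?I = "indifferent_instance n"
  \<comment> \<open>The witness lies in the restricted family, so it serves both maxima; the upper
    bound for all instances covers the restricted ones.\<close>
  have "hrt_mslq_instance ?I \<and> card (residents ?I) = n \<and>
      resident_master_list ?I \<and> hospitals_without_ties ?I \<and> real n + 1 = OPT ?I / WST ?I"
    using indifferent_instance[OF assms] indifferent_instance_master_list
      indifferent_instance_without_ties OPT_div_WST_indifferent_instance[OF assms] by simp
  moreover have "OPT I / WST I \<le> real n + 1"
    if "hrt_mslq_instance I" "card (residents I) = n" for I :: "(nat, nat) hrt_mslq"
    using OPT_div_WST_le[OF that(1)] that(2) by simp
  ultimately show ?thesis unfolding is_maximum_def by blast
qed

end
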